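(* Let $(E,T,S,e)$ be a conditionally ergodic conditional expectation preserving system with $T$ strictly positive, $E$ $T$-universally complete and $S$ surjective. If $(S,e)$ is aperiodic, $n\in\mathbb{N}$ and $\epsilon>0$, then there exists a component $q$ of $e$ in $E$ such that $q,Sq,\dots,S^{n-1}q$ are pairwise disjoint and $$T\left(e-\bigvee_{i=0}^{n-1}S^i q\right)\le \epsilon e.$$
   Context: $\mathbb{N}=\{1,2,\dots\}$. For an Archimedean Riesz space $E$ with weak order unit, a conditional expectation on $E$ is a positive order continuous linear projection $T:E\to E$ which maps weak order units to weak order units and whose range $R(T)$ is a Dedekind complete Riesz subspace of $E$. $T$ is strictly positive if $f\in E_+$ and $Tf=0$ imply $f=0$. A conditional expectation preserving system (CEPS) is a 4-tuple $(E,T,S,e)$ where $E$ is a Dedekind complete Riesz space, $e$ is a weak order unit of $E$, $T$ is a conditional expectation on $E$ with $Te=e$, and $S$ is an order continuous Riesz homomorphism on $E$ with $Se=e$ and $TSf=Tf$ for all $f\in E$. When $T$ is strictly positive, $S$ is injective, so if $S$ is also surjective it is bijective and $S^{-1}$ is a Riesz homomorphism. $E^u$ denotes the universal completion of $E$. $E$ is $T$-universally complete if for each upwards directed net $(f_\alpha)$ in $E_+$ such that $(Tf_\alpha)$ is order bounded in $E^u$, the net $(f_\alpha)$ is order convergent in $E$. If $E$ is $T$-universally complete, then for each $f\in E$ the order limit $L_Sf:=\lim_{n\to\infty}\frac1n\sum_{k=0}^{n-1}S^kf$ exists in $E$. The system is conditionally ergodic if $L_S=T$ (equivalently $\{f\in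 E: Sf=f\}=R(T)$). $p\in E_+$ is a component of $q\in E_+$ if $p\le q$ and $(q-p)\wedge p=0$. Elements $f,g\in E_+$ are disjoint if $f\wedge g=0$. For a component $p$ of $e$ and $k\in\mathbb{N}$, $q(p,k):=p\wedge (S^{-k}p)\wedge\left(e-\bigvee_{j=1}^{k-1}S^{-j}p\right)$, where the supremum of an empty family of components is $0$. For a component $v\neq0$ of $e$, $(S,v)$ is aperiodic if for each $N\in\mathbb{N}$ and each component $c\ne0$ of $v$ there exist $k\ge N$ and a component $u$ of $c$ with $q(u,k)\neq0$. *)

theory Defs
  imports Complex_Main "HOL-Library.Lattice_Algebras"
begin

text \<open>Riesz spaces are types; the modulus is the lattice-group one, \<open>\<bar>x\<bar> = sup x (- x)\<close>.
  In a conditionally complete lattice every nonempty set that is bounded above has a supremum,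
  which is Dedekind completeness; \<open>Sup\<close> and \<open>Inf\<close> are meaningful only for nonempty sets that are
  bounded on the relevant side.\<close>

class riesz_space = ordered_real_vector + lattice_ab_group_add_abs

class dedekind_complete_riesz_space = riesz_space + conditionally_complete_lattice

subsection \<open>Order convergence\<close>

text \<open>The net \<open>(f i)\<close>, indexed by the directed set \<open>I\<close>, order converges to \<open>l\<close>: it is dominated by a
  net \<open>u\<close> on the same index set with \<open>u \<down> 0\<close>.\<close>

definition order_converges ::
    "'i::order set \<Rightarrow> ('i \<Rightarrow> 'a::dedekind_complete_riesz_space) \<Rightarrow> 'a \<Rightarrow> bool" where
  "order_converges I f l \<longleftrightarrow>
     (\<exists>u. monotone_on I (\<le>) (\<ge>) u \<and> bdd_below (u ` I) \<and> Inf (u ` I) = 0 \<and>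
          (\<forall>i\<in>I. \<bar>f i - l\<bar> \<le> u i))"

definition upward_directed :: "'a::order set \<Rightarrow> bool" where
  "upward_directed D \<longleftrightarrow> D \<noteq> {} \<and> (\<forall>x\<in>D. \<forall>y\<in>D. \<exists>z\<in>D. x \<le> z \<and> y \<le> z)"

definition downward_directed :: "'a::order set \<Rightarrow> bool" where
  "downward_directed D \<longleftrightarrow> D \<noteq> {} \<and> (\<forall>x\<in>D. \<forall>y\<in>D. \<exists>z\<in>D. z \<le> x \<and> z \<le> y)"

definition decreases_to_zero :: "'a::dedekind_complete_riesz_space set \<Rightarrow> bool" where
  "decreases_to_zero D \<longleftrightarrow> downward_directed D \<and> bdd_below D \<and> Inf D = 0"

subsection \<open>Operators\<close>

definition positive_operator :: "('a::riesz_space \<Rightarrow> 'b::riesz_space) \<Rightarrow> bool" where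
  "positive_operator T \<longleftrightarrow> linear T \<and> (\<forall>f. 0 \<le> f \<longrightarrow> 0 \<le> T f)"

definition riesz_hom :: "('a::riesz_space \<Rightarrow> 'b::riesz_space) \<Rightarrow> bool" where
  "riesz_hom S \<longleftrightarrow> linear S \<and> (\<forall>f g. S (sup f g) = sup (S f) (S g)) \<and>
     (\<forall>f g. S (inf f g) = inf (S f) (S g))"

text \<open>Order continuity in the form used for positive operators: \<open>D \<down> 0\<close> implies \<open>T D \<down> 0\<close>.\<close>

definition order_continuous ::
    "('a::dedekind_complete_riesz_space \<Rightarrow> 'b::dedekind_complete_riesz_space) \<Rightarrow> bool" where
  "order_continuous T \<longleftrightarrow> (\<forall>D. decreases_to_zero D \<longrightarrow> decreases_to_zero (T ` D))"

definition riesz_subspace :: "'a::riesz_space set \<Rightarrow> bool" where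
  "riesz_subspace X \<longleftrightarrow> subspace X \<and> (\<forall>f\<in>X. \<forall>g\<in>X. sup f g \<in> X \<and> inf f g \<in> X)"

definition is_lub_in :: "'a::order set \<Rightarrow> 'a set \<Rightarrow> 'a \<Rightarrow> bool" where
  "is_lub_in X A s \<longleftrightarrow> s \<in> X \<and> (\<forall>a\<in>A. a \<le> s) \<and> (\<forall>z\<in>X. (\<forall>a\<in>A. a \<le> z) \<longrightarrow> s \<le> z)"

text \<open>Dedekind completeness of \<open>X\<close> as an ordered set in its own right: bounds and suprema are
  taken inside \<open>X\<close>, not in the ambient space.\<close>

definition dedekind_complete_on :: "'a::order set \<Rightarrow> bool" where
  "dedekind_complete_on X \<longleftrightarrow>
     (\<forall>A\<subseteq>X. A \<noteq> {} \<longrightarrow> (\<exists>b\<in>X. \<forall>a\<in>A. a \<le> b) \<longrightarrow> (\<exists>s. is_lub_in X A s))"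

definition weak_order_unit :: "'a::riesz_space \<Rightarrow> bool" where
  "weak_order_unit e \<longleftrightarrow> 0 \<le> e \<and> (\<forall>f. 0 \<le> f \<longrightarrow> inf f e = 0 \<longrightarrow> f = 0)"

definition conditional_expectation ::
    "('a::dedekind_complete_riesz_space \<Rightarrow> 'a) \<Rightarrow> bool" where
  "conditional_expectation T \<longleftrightarrow>
     positive_operator T \<and> order_continuous T \<and> (\<forall>f. T (T f) = T f) \<and>
     (\<forall>w. weak_order_unit w \<longrightarrow> weak_order_unit (T w)) \<and>
     riesz_subspace (range T) \<and> dedekind_complete_on (range T)"

definition strictly_positive :: "('a::riesz_space \<Rightarrow> 'a) \<Rightarrow> bool" where
  "strictly_positive T \<longleftrightarrow> (\<forall>f. 0 \<le> f \<longrightarrow> T f = 0 \<longrightarrow> f = 0)"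

text \<open>The space \<open>E\<close> of the system \<open>(E, T, S, e)\<close> is the type \<open>'a\<close>.\<close>

definition CEPS ::
    "('a::dedekind_complete_riesz_space \<Rightarrow> 'a) \<Rightarrow> ('a \<Rightarrow> 'a) \<Rightarrow> 'a \<Rightarrow> bool" where
  "CEPS T S e \<longleftrightarrow>
     weak_order_unit e \<and> conditional_expectation T \<and> T e = e \<and>
     riesz_hom S \<and> order_continuous S \<and> S e = e \<and> (\<forall>f. T (S f) = T f)"

subsection \<open>Universal completion and \<open>T\<close>-universal completeness\<close>

definition laterally_complete :: "'b::riesz_space itself \<Rightarrow> bool" where
  "laterally_complete _ \<longleftrightarrow>
     (\<forall>A::'b set. A \<noteq> {} \<longrightarrow> (\<forall>a\<in>A. 0 \<le> a) \<longrightarrow> pairwise (\<lambda>a b. inf a b = 0) A \<longrightarrow>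
        (\<exists>s. is_lub_in UNIV A s))"

text \<open>\<open>j\<close> exhibits \<open>'b\<close> as the universal completion of \<open>'a\<close> (unique up to Riesz isomorphism): \<open>'b\<close> is
  universally complete, i.e. Dedekind and laterally complete, and \<open>j\<close> embeds \<open>'a\<close> as an order dense
  Riesz subspace of \<open>'b\<close>.\<close>

definition universal_completion ::
    "('a::riesz_space \<Rightarrow> 'b::dedekind_complete_riesz_space) \<Rightarrow> bool" where
  "universal_completion j \<longleftrightarrow>
     laterally_complete TYPE('b) \<and> riesz_hom j \<and> inj j \<and>
     (\<forall>y. 0 < y \<longrightarrow> (\<exists>z\<in>range j. 0 < z \<and> z \<le> y))"

text \<open>An upwards directed net is represented by the upward directed set of its members, indexed by
  itself; order boundedness of \<open>T D\<close> refers to the universal completion, via \<open>j\<close>.\<close>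

definition T_universally_complete ::
    "('a::dedekind_complete_riesz_space \<Rightarrow> 'b::dedekind_complete_riesz_space) \<Rightarrow>
     ('a \<Rightarrow> 'a) \<Rightarrow> bool" where
  "T_universally_complete j T \<longleftrightarrow>
     (\<forall>D. upward_directed D \<longrightarrow> (\<forall>f\<in>D. 0 \<le> f) \<longrightarrow> (\<exists>a b. \<forall>f\<in>D. a \<le> j (T f) \<and> j (T f) \<le> b) \<longrightarrow>
        (\<exists>l. order_converges D (\<lambda>f. f) l))"

subsection \<open>Ergodicity and aperiodicity\<close>

text \<open>\<open>L\<^sub>S f = l\<close>. The averages are indexed from \<open>n = 0\<close>, so the length is \<open>Suc n\<close>.\<close>

definition ergodic_limit ::
    "('a::dedekind_complete_riesz_space \<Rightarrow> 'a) \<Rightarrow> 'a \<Rightarrow> 'a \<Rightarrow> bool" where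
  "ergodic_limit S f l \<longleftrightarrow>
     order_converges UNIV (\<lambda>n::nat. (1 / real (Suc n)) *\<^sub>R (\<Sum>k<Suc n. (S ^^ k) f)) l"

definition conditionally_ergodic ::
    "('a::dedekind_complete_riesz_space \<Rightarrow> 'a) \<Rightarrow> ('a \<Rightarrow> 'a) \<Rightarrow> bool" where
  "conditionally_ergodic T S \<longleftrightarrow> (\<forall>f. ergodic_limit S f (T f))"

definition is_component :: "'a::riesz_space \<Rightarrow> 'a \<Rightarrow> bool" where
  "is_component p q \<longleftrightarrow> 0 \<le> p \<and> 0 \<le> q \<and> p \<le> q \<and> inf (q - p) p = 0"

text \<open>The component of the first return at time \<open>k\<close>, for bijective \<open>S\<close>. Inserting \<open>0\<close> leaves the
  supremum of a nonempty family of components unchanged and makes that of the empty family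
  (\<open>k = 1\<close>) equal to \<open>0\<close>.\<close>

definition first_return ::
    "('a::dedekind_complete_riesz_space \<Rightarrow> 'a) \<Rightarrow> 'a \<Rightarrow> 'a \<Rightarrow> nat \<Rightarrow> 'a" where
  "first_return S e p k =
     inf (inf p ((inv S ^^ k) p)) (e - Sup (insert 0 ((\<lambda>j. (inv S ^^ j) p) ` {1..<k})))"

definition aperiodic ::
    "('a::dedekind_complete_riesz_space \<Rightarrow> 'a) \<Rightarrow> 'a \<Rightarrow> 'a \<Rightarrow> bool" where
  "aperiodic S e v \<longleftrightarrow> is_component v e \<and> v \<noteq> 0 \<and>
     (\<forall>N\<ge>1. \<forall>c. is_component c v \<longrightarrow> c \<noteq> 0 \<longrightarrow>
        (\<exists>k\<ge>N. \<exists>u. is_component u c \<and> first_return S e u k \<noteq> 0))"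

end

theory Submission
  imports Defs
begin

text \<open>By Zorn's lemma there is a maximal component \<open>p\<close> of \<open>e\<close> such that \<open>p, S p, \<dots>, S\<^sup>N\<^sup>-\<^sup>1 p\<close> are
  pairwise disjoint. Aperiodicity provides such components below every nonzero component, so by
  maximality the only \<open>S\<close>-invariant component above \<open>p\<close> is \<open>e\<close>. Cutting \<open>e\<close> according to the time
  elapsed since the last visit to \<open>p\<close> gives levels \<open>A\<^sub>0 = p\<close>, \<open>A\<^sub>k\<^sub>+\<^sub>1 = S A\<^sub>k \<and> (e - p)\<close>. They are
  disjoint, and their supremum \<open>v\<close> satisfies \<open>S v \<le> v\<close>; strict positivity of \<open>T\<close> makes it invariant,
  so \<open>v = e\<close>. The base \<open>q\<close> consists of the part of the levels \<open>A\<^sub>0, A\<^sub>n, A\<^sub>2\<^sub>n, \<dots>\<close> that does not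
  meet \<open>p\<close> during the next \<open>n\<close> steps. What the tower over \<open>q\<close> misses lies below
  \<open>S\<^sup>-\<^sup>1 p + \<dots> + S\<^sup>-\<^sup>n p\<close>, and \<open>T\<close> maps this sum to \<open>n T p \<le> (n / N) e\<close>.\<close>

subsection \<open>Components\<close>

lemma is_component_iff_inf:
  fixes p :: "'a::riesz_space"
  shows "is_component p e \<longleftrightarrow> inf p (e - p) = 0"
proof
  assume h: "inf p (e - p) = 0"
  have "0 \<le> p" "0 \<le> e - p" using h by (metis inf.cobounded1, metis h inf.cobounded2)
  then have "0 \<le> e" "p \<le> e" by (auto intro: order_trans)
  then show "is_component p e" using h \<open>0 \<le> p\<close> by (simp add: is_component_def inf.commute)
qed (simp add: is_component_def inf.commute)

lemma is_componentD:
  assumes "is_component p e"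
  shows "0 \<le> p" "p \<le> e" "0 \<le> e"
  using assms by (auto simp: is_component_def)

lemma is_component_compl: "is_component p e \<Longrightarrow> is_component (e - p) e"
  by (simp add: is_component_iff_inf inf.commute)

lemma is_component_zero: "0 \<le> e \<Longrightarrow> is_component 0 e"
  by (simp add: is_component_def inf_absorb2)

lemma disjoint_mono:
  fixes a b c d :: "'a::riesz_space"
  assumes "inf c d = 0" "a \<le> c" "b \<le> d" "0 \<le> a" "0 \<le> b"
  shows "inf a b = 0"
  by (metis assms inf_mono antisym le_inf_iff)

lemma disjoint_add_eq_sup:
  fixes a b :: "'a::riesz_space"
  assumes "inf a b = 0"
  shows "a + b = sup a b"
  using add_eq_inf_sup[of a b] assms by simp

text \<open>A disjoint sum is a supremum and so stays below \<open>e\<close>; conversely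
  \<open>b\<close> is disjoint from \<open>e - b\<close>. In the inequality form, disjointness
  passes to suprema by \<open>cSup_least\<close>.\<close>

lemma disjoint_component_iff:
  fixes a b :: "'a::riesz_space"
  assumes "is_component a e" "is_component b e"
  shows "inf a b = 0 \<longleftrightarrow> a \<le> e - b"
proof
  assume "inf a b = 0"
  then have "a + b \<le> e"
    using disjoint_add_eq_sup[of a b] is_componentD[OF assms(1)] is_componentD[OF assms(2)] by simp
  then show "a \<le> e - b" by (simp add: le_diff_eq)
next
  assume "a \<le> e - b"
  then show "inf a b = 0"
    using assms disjoint_mono[of "e - b" b a b] is_componentD[OF assms(1)] is_componentD[OF assms(2)]
    by (simp add: is_component_iff_inf inf.commute)
qed

text \<open>Disjointness rewrites \<open>x + y\<close> as \<open>sup x y\<close>, so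
  \<open>sup s y - y\<close> bounds every \<open>x\<close> and hence \<open>s\<close>. An abstract
  least upper bound serves both binary and infinite suprema.\<close>

lemma disjoint_lub:
  fixes s y :: "'a::riesz_space"
  assumes disj: "\<And>x. x \<in> X \<Longrightarrow> inf x y = 0"
    and ub: "\<And>x. x \<in> X \<Longrightarrow> x \<le> s"
    and least: "\<And>z. (\<And>x. x \<in> X \<Longrightarrow> x \<le> z) \<Longrightarrow> s \<le> z"
    and "0 \<le> s" "0 \<le> y"
  shows "inf s y = 0"
proof -
  have "x \<le> sup s y - y" if "x \<in> X" for x
  proof -
    have "x + y = sup x y" using disj[OF that] by (rule disjoint_add_eq_sup)
    also have "\<dots> \<le> sup s y" using ub[OF that] by (auto intro: le_supI1)
    finally show ?thesis by (simp add: le_diff_eq)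
  qed
  then have "s \<le> sup s y - y" by (rule least)
  then have "s + y \<le> sup s y" by (simp add: le_diff_eq)
  then have "inf s y \<le> 0" using add_eq_inf_sup[of s y] by simp
  then show ?thesis using assms(4,5) by (simp add: antisym)
qed

lemma disjoint_sup:
  fixes a b y :: "'a::riesz_space"
  assumes "inf a y = 0" "inf b y = 0" "0 \<le> a" "0 \<le> y"
  shows "inf (sup a b) y = 0"
  by (rule disjoint_lub[of "{a, b}"]) (use assms in \<open>auto intro: le_supI1\<close>)

lemma disjoint_Sup:
  fixes y :: "'a::dedekind_complete_riesz_space"
  assumes "\<And>x. x \<in> X \<Longrightarrow> inf x y = 0" "\<And>x. x \<in> X \<Longrightarrow> 0 \<le> x" "X \<noteq> {}" "bdd_above X" "0 \<le> y"
  shows "inf (Sup X) y = 0"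
proof (rule disjoint_lub[of X])
  obtain x where "x \<in> X" using assms(3) by blast
  then show "0 \<le> Sup X" using assms(2,4) cSup_upper order_trans by blast
qed (use assms in \<open>auto intro: cSup_upper cSup_least\<close>)

lemma is_component_sup:
  fixes a b :: "'a::riesz_space"
  assumes "is_component a e" "is_component b e"
  shows "is_component (sup a b) e"
proof -
  note a = is_componentD[OF assms(1)] and b = is_componentD[OF assms(2)]
  have "inf c (e - sup a b) = 0" if "is_component c e" "c \<le> sup a b" for c
  proof (rule disjoint_mono[of c "e - c"])
    show "inf c (e - c) = 0" using that(1) by (simp add: is_component_iff_inf)
    show "e - sup a b \<le> e - c" using that(2) by (rule diff_left_mono)
    show "0 \<le> e - sup a b" using a b by (metis diff_ge_0_iff_ge le_supI)
  qed (use is_componentD[OF that(1)] in auto)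
  then have "inf a (e - sup a b) = 0" "inf b (e - sup a b) = 0" using assms by auto
  moreover have "0 \<le> e - sup a b" using a b by (metis diff_ge_0_iff_ge le_supI)
  ultimately show ?thesis unfolding is_component_iff_inf
    using a b by (intro disjoint_sup)
qed

lemma is_component_inf:
  fixes a b :: "'a::riesz_space"
  assumes "is_component a e" "is_component b e"
  shows "is_component (inf a b) e"
proof -
  have "e - sup (e - a) (e - b) = inf a b"
    by (simp add: add_inf_distrib_left)
  then show ?thesis
    using is_component_compl[OF is_component_sup[OF assms[THEN is_component_compl]]] by simp
qed

lemma bdd_above_components: "(\<And>x. x \<in> X \<Longrightarrow> is_component x e) \<Longrightarrow> bdd_above X"
  by (meson bdd_above.I is_componentD(2))

lemma is_component_Sup:
  fixes X :: "'a::dedekind_complete_riesz_space set"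
  assumes X: "\<And>x. x \<in> X \<Longrightarrow> is_component x e" and "X \<noteq> {}"
  shows "is_component (Sup X) e"
  unfolding is_component_iff_inf
proof (rule disjoint_Sup)
  note bdd = bdd_above_components[OF X]
  have le: "Sup X \<le> e" using X is_componentD(2) \<open>X \<noteq> {}\<close> by (blast intro: cSup_least)
  then show "0 \<le> e - Sup X" by simp
  fix x assume x: "x \<in> X"
  then have "e - Sup X \<le> e - x" by (simp add: bdd cSup_upper diff_left_mono)
  moreover have "inf x (e - x) = 0" using X[OF x] by (simp add: is_component_iff_inf)
  ultimately show "inf x (e - Sup X) = 0"
    using disjoint_mono is_componentD(1)[OF X[OF x]] le by (metis diff_ge_0_iff_ge order_refl)
qed (use assms bdd_above_components[OF X] in \<open>auto dest: is_componentD\<close>)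

text \<open>\<open>e - u\<close> is the disjoint sum of \<open>c - u\<close> and
  \<open>e - c\<close>, and both summands are disjoint from \<open>u\<close>.\<close>

lemma is_component_trans:
  fixes u c e :: "'a::riesz_space"
  assumes "is_component u c" "is_component c e"
  shows "is_component u e"
proof -
  note u = is_componentD[OF assms(1)] and c = is_componentD[OF assms(2)]
  have "inf (c - u) u = 0" using assms(1) by (simp add: is_component_def)
  moreover have "inf (e - c) u = 0"
    using assms u c disjoint_mono[of "e - c" c "e - c" u] by (simp add: is_component_def)
  ultimately have "inf (sup (c - u) (e - c)) u = 0"
    using u by (intro disjoint_sup) auto
  moreover have "sup (c - u) (e - c) = (c - u) + (e - c)"
    using assms u c disjoint_mono[of "e - c" c "e - c" "c - u"]
    by (intro disjoint_add_eq_sup[symmetric]) (simp add: is_component_def inf.commute)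
  ultimately show ?thesis by (simp add: is_component_iff_inf inf.commute)
qed

lemma sum_disjoint_components_le:
  fixes f :: "nat \<Rightarrow> 'a::riesz_space"
  assumes "0 \<le> e" and f: "\<And>i. i < n \<Longrightarrow> is_component (f i) e"
    and disj: "\<And>i k. i < k \<Longrightarrow> k < n \<Longrightarrow> inf (f i) (f k) = 0"
  shows "(\<Sum>i<n. f i) \<le> e"
proof -
  \<comment> \<open>The induction must also keep each partial sum disjoint from the terms still to
    come; only then is the next sum a supremum of components.\<close>
  have "is_component (\<Sum>i<m. f i) e \<and> (\<forall>k. m \<le> k \<longrightarrow> k < n \<longrightarrow> inf (\<Sum>i<m. f i) (f k) = 0)"
    if "m \<le> n" for m
    using that
  proof (induction m)
    case 0
    then show ?case
      using \<open>0 \<le> e\<close> f by (auto simp: is_component_zero intro: inf_absorb1 dest: is_componentD)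
  next
    case (Suc m)
    have "(\<Sum>i<Suc m. f i) = sup (\<Sum>i<m. f i) (f m)"
      using Suc by (simp add: disjoint_add_eq_sup)
    moreover have "inf (sup (\<Sum>i<m. f i) (f m)) (f k) = 0" if "Suc m \<le> k" "k < n" for k
      using that Suc disj[of m k] f by (intro disjoint_sup) (auto dest: is_componentD)
    ultimately show ?case using Suc f[of m] is_component_sup by auto
  qed
  then show ?thesis using is_componentD(2) by blast
qed

subsection \<open>Riesz automorphisms fixing the unit\<close>

text \<open>Bijectivity makes \<open>F\<close> and \<open>inv F\<close> order isomorphisms, and
  fixing \<open>e\<close> makes both map components of \<open>e\<close> to components of
  \<open>e\<close>.\<close>

definition unit_automorphism :: "'a::riesz_space \<Rightarrow> ('a \<Rightarrow> 'a) \<Rightarrow> bool" where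
  "unit_automorphism e F \<longleftrightarrow> riesz_hom F \<and> bij F \<and> F e = e"

lemma unit_automorphismD:
  assumes "unit_automorphism e F"
  shows "linear F" "F (sup f g) = sup (F f) (F g)" "F (inf f g) = inf (F f) (F g)"
    "inj F" "F 0 = 0" "F (f - g) = F f - F g" "F e = e" "F f = F g \<longleftrightarrow> f = g"
  using assms
  by (auto simp: unit_automorphism_def riesz_hom_def bij_def linear_0 linear_diff inj_eq)

lemma unit_automorphism_le_iff: "unit_automorphism e F \<Longrightarrow> F a \<le> F b \<longleftrightarrow> a \<le> b"
  by (metis inf.order_iff unit_automorphismD(3,8))

lemma unit_automorphism_disjoint_iff:
  "unit_automorphism e F \<Longrightarrow> inf (F a) (F b) = 0 \<longleftrightarrow> inf a b = 0"
  by (metis unit_automorphismD(3,5,8))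

lemma unit_automorphism_component:
  "unit_automorphism e F \<Longrightarrow> is_component p e \<Longrightarrow> is_component (F p) e"
  unfolding is_component_iff_inf by (metis unit_automorphism_disjoint_iff unit_automorphismD(6,7))

lemma unit_automorphism_funpow:
  "unit_automorphism e F \<Longrightarrow> unit_automorphism e (F ^^ n)"
proof (induction n)
  case 0
  then show ?case
    by (simp add: unit_automorphism_def riesz_hom_def linear_id flip: id_def)
next
  case (Suc n)
  then show ?case
    using linear_compose[of "F ^^ n" F] bij_comp[of "F ^^ n" F]
    by (auto simp: unit_automorphism_def riesz_hom_def o_def)
qed

lemma unit_automorphism_inv:
  assumes F: "unit_automorphism e F"
  shows "unit_automorphism e (inv F)"
proof -
  have bij: "bij F" using F by (simp add: unit_automorphism_def)
  then have s: "F (inv F x) = x" and i: "inv F x = y \<longleftrightarrow> x = F y" for x y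
    by (auto simp: bij_def surj_f_inv_f)
  have "linear (inv F)"
    using unit_automorphismD(1)[OF F] by (intro linearI) (simp_all add: i s linear_add linear_scale)
  then show ?thesis
    unfolding unit_automorphism_def riesz_hom_def
    using bij unit_automorphismD[OF F] by (simp add: i s bij_imp_bij_inv)
qed

lemma unit_automorphism_funpow_inv:
  assumes "unit_automorphism e F"
  shows "(F ^^ n) ((inv F ^^ n) x) = x"
proof (induction n arbitrary: x)
  case (Suc n)
  have "F (inv F y) = y" for y
    using assms by (simp add: unit_automorphism_def bij_is_surj surj_f_inv_f)
  then show ?case using Suc by (simp add: funpow_swap1)
qed simp

text \<open>This adjunction is how powers of \<open>S\<close> are carried past a \<open>Sup\<close>:
  move the power to the other side, take the supremum there, and move it back.\<close>

lemma unit_automorphism_funpow_le_iff: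
  assumes "unit_automorphism e F"
  shows "(F ^^ n) a \<le> b \<longleftrightarrow> a \<le> (inv F ^^ n) b"
  by (metis assms unit_automorphism_funpow unit_automorphism_funpow_inv unit_automorphism_le_iff)

lemma unit_automorphism_invariant_funpow: "F v = v \<Longrightarrow> (F ^^ n) v = v"
  by (induction n) simp_all

subsection \<open>A maximal component with long return times\<close>

text \<open>What first returns to \<open>u\<close> at time \<open>k\<close> avoids \<open>u\<close>
  at the times strictly between \<open>0\<close> and \<open>k\<close>, and in particular avoids its
  own subset of \<open>u\<close>. This turns large return times into disjoint translates.\<close>

lemma first_return_component:
  assumes aut: "unit_automorphism e S" and u: "is_component u e"
  shows "is_component (first_return S e u k) e"
    and "first_return S e u k \<le> u"
    and "0 < i \<Longrightarrow> i < k \<Longrightarrow>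
      inf (first_return S e u k) ((S ^^ i) (first_return S e u k)) = 0"
proof -
  define w where "w = first_return S e u k"
  define X where "X = insert 0 ((\<lambda>j. (inv S ^^ j) u) ` {1..<k})"
  have comp: "is_component ((inv S ^^ j) u) e" for j
    using aut u unit_automorphism_inv unit_automorphism_funpow unit_automorphism_component by blast
  have X: "is_component x e" if "x \<in> X" for x
    using that comp is_componentD(3)[OF u] unfolding X_def by (auto simp: is_component_zero)
  have w_eq: "w = inf (inf u ((inv S ^^ k) u)) (e - Sup X)"
    by (simp add: w_def first_return_def X_def)
  have "is_component (Sup X) e"
    by (rule is_component_Sup[OF X]) (auto simp: X_def)
  then show w: "is_component (first_return S e u k) e"
    using w_eq comp[of k] u unfolding w_def
    by (simp add: is_component_inf is_component_compl)
  show wu: "first_return S e u k \<le> u" using w_eq w_def by (simp add: le_infI1)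
  assume i: "0 < i" "i < k"
  have S: "unit_automorphism e (S ^^ i)" using aut by (rule unit_automorphism_funpow)
  have "(inv S ^^ i) u \<le> Sup X"
    using i bdd_above_components[OF X] by (intro cSup_upper) (auto simp: X_def)
  then have "w \<le> e - (inv S ^^ i) u" by (metis w_eq le_infE diff_left_mono order_trans order_refl)
  then have "inf w ((inv S ^^ i) u) = 0"
    using disjoint_component_iff[OF w comp] by (simp add: w_def)
  then have "inf ((S ^^ i) w) u = 0"
    using unit_automorphism_disjoint_iff[OF S, of w "(inv S ^^ i) u"]
    by (simp add: unit_automorphism_funpow_inv[OF aut])
  then show "inf (first_return S e u k) ((S ^^ i) (first_return S e u k)) = 0"
    using disjoint_mono[of "(S ^^ i) w" u "(S ^^ i) w" w] wu is_componentD(1)[OF w]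
      is_componentD(1)[OF unit_automorphism_component[OF S w]]
    by (simp add: w_def inf.commute)
qed

text \<open>If an invariant \<open>v\<close> above a maximal \<open>p\<close> were not
  \<open>e\<close>, aperiodicity would give a nonzero \<open>w\<close> below \<open>e - v\<close>
  with the same disjointness. Translates of \<open>p\<close> stay below \<open>v\<close> and those
  of \<open>w\<close> below \<open>e - v\<close>, so \<open>sup p w\<close> would contradict
  maximality.\<close>

lemma maximal_wandering_component:
  assumes aut: "unit_automorphism e S" and "aperiodic S e e" and N: "1 \<le> N"
  obtains p where "is_component p e" "\<And>i. 0 < i \<Longrightarrow> i < N \<Longrightarrow> inf p ((S ^^ i) p) = 0"
    and "\<And>v. is_component v e \<Longrightarrow> p \<le> v \<Longrightarrow> S v = v \<Longrightarrow> v = e"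
proof -
  define W where
    "W = {p. is_component p e \<and> (\<forall>i. 0 < i \<longrightarrow> i < N \<longrightarrow> inf p ((S ^^ i) p) = 0)}"
  have e0: "0 \<le> e" using assms(2) by (simp add: aperiodic_def is_component_def)
  note S = unit_automorphism_funpow[OF aut]
  note comp_S = unit_automorphism_component[OF S]
  have "\<exists>m\<in>W. \<forall>a\<in>W. m \<le> a \<longrightarrow> a = m"
  proof (rule predicate_Zorn)
    show "partial_order_on W (relation_of (\<le>) W)"
      by (rule partial_order_on_relation_ofI) auto
    fix C assume "C \<in> Chains (relation_of (\<le>) W)"
    then have chain: "x \<le> y \<or> y \<le> x" if "x \<in> C" "y \<in> C" for x y
      using that by (auto simp: Chains_def relation_of_def)
    have CW: "C \<subseteq> W"
      using \<open>C \<in> Chains (relation_of (\<le>) W)\<close> by (auto simp: Chains_def relation_of_def)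
    show "\<exists>u\<in>W. \<forall>a\<in>C. a \<le> u"
    proof (cases "C = {}")
      case True
      \<comment> \<open>The empty chain is separate because \<open>Sup {}\<close> carries no meaning
        here.\<close>
      have "0 \<in> W"
        using e0 unit_automorphismD(5)[OF S] by (simp add: W_def is_component_zero)
      then show ?thesis using True by auto
    next
      case False
      have C: "is_component c e" if "c \<in> C" for c using CW that by (auto simp: W_def)
      note p = is_component_Sup[OF C False]
      note ub = cSup_upper[OF _ bdd_above_components[OF C]]
      have "inf (Sup C) ((S ^^ i) (Sup C)) = 0" if i: "0 < i" "i < N" for i
      proof -
        \<comment> \<open>The mixed inequality for \<open>a\<close> and \<open>b\<close> comes from
          the larger of the two, which lies in \<open>W\<close>.\<close>
        have "a \<le> e - (S ^^ i) b" if ab: "a \<in> C" "b \<in> C" for a b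
        proof -
          obtain c where c: "c \<in> C" "a \<le> c" "b \<le> c" using chain[OF ab] ab by blast
          have "inf c ((S ^^ i) c) = 0" using c(1) CW i by (auto simp: W_def)
          then have "c \<le> e - (S ^^ i) c"
            using disjoint_component_iff C[OF c(1)] comp_S by blast
          moreover have "(S ^^ i) b \<le> (S ^^ i) c" using c unit_automorphism_le_iff[OF S] by blast
          ultimately show ?thesis using c(2) by (meson diff_left_mono order_trans)
        qed
        then have "Sup C \<le> e - (S ^^ i) b" if "b \<in> C" for b
          using that False by (blast intro: cSup_least)
        then have "(S ^^ i) b \<le> e - Sup C" if "b \<in> C" for b
          using that by (metis le_diff_eq add.commute)
        \<comment> \<open>The supremum over \<open>a\<close> is already taken; the one over
          \<open>b\<close> needs \<open>S ^^ i\<close> on the right-hand side first.\<close>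
        then have "Sup C \<le> (inv S ^^ i) (e - Sup C)"
          using False unit_automorphism_funpow_le_iff[OF aut] by (blast intro: cSup_least)
        then have "(S ^^ i) (Sup C) \<le> e - Sup C"
          using unit_automorphism_funpow_le_iff[OF aut] by blast
        then show ?thesis using disjoint_component_iff[OF comp_S[OF p] p] by (simp add: inf.commute)
      qed
      then have "Sup C \<in> W" using p by (simp add: W_def)
      then show ?thesis using ub by blast
    qed
  qed
  then obtain p where "p \<in> W" and max: "\<And>a. a \<in> W \<Longrightarrow> p \<le> a \<Longrightarrow> a = p" by blast
  then have p: "is_component p e" and pi: "\<And>i. 0 < i \<Longrightarrow> i < N \<Longrightarrow> inf p ((S ^^ i) p) = 0"
    by (auto simp: W_def)
  have "v = e" if v: "is_component v e" "p \<le> v" "S v = v" for v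
  proof (rule ccontr)
    assume "v \<noteq> e"
    then have "is_component (e - v) e" "e - v \<noteq> 0" using v is_component_compl by auto
    \<comment> \<open>A return time \<open>k\<close> of at least \<open>N\<close> covers every
      \<open>i\<close> below \<open>N\<close>.\<close>
    then obtain k u where k: "N \<le> k" and u: "is_component u (e - v)"
      and nz: "first_return S e u k \<noteq> 0"
      using assms(2) N unfolding aperiodic_def by meson
    have u': "is_component u e"
      using is_component_trans[OF u] is_component_compl[OF v(1)] .
    define w where "w = first_return S e u k"
    have w: "is_component w e" and "w \<le> u"
      and wi: "\<And>i. 0 < i \<Longrightarrow> i < N \<Longrightarrow> inf w ((S ^^ i) w) = 0"
      using first_return_component[OF aut u'] k by (auto simp: w_def)
    have wv: "w \<le> e - v" using \<open>w \<le> u\<close> is_componentD(2)[OF u] by (rule order_trans)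
    have pw: "inf x y = 0" if "is_component x e" "is_component y e" "x \<le> v" "y \<le> e - v" for x y
      using that v by (metis disjoint_component_iff order_trans le_diff_eq add.commute)
    have "sup p w \<in> W" unfolding W_def
    proof (intro CollectI conjI allI impI)
      show "is_component (sup p w) e" using p w by (rule is_component_sup)
      fix i assume i: "0 < i" "i < N"
      have inv: "(S ^^ i) v = v" using v(3) by (rule unit_automorphism_invariant_funpow)
      have "(S ^^ i) p \<le> v" using unit_automorphism_le_iff[OF S] v(2) inv by metis
      moreover have "(S ^^ i) w \<le> e - v"
        using unit_automorphism_le_iff[OF S] wv inv unit_automorphismD(6,7)[OF S] by metis
      ultimately have "inf w ((S ^^ i) p) = 0" "inf p ((S ^^ i) w) = 0"
        using pw comp_S p w v(2) wv by (auto simp: inf.commute[of w])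
      then have "inf (sup p w) ((S ^^ i) p) = 0" "inf (sup p w) ((S ^^ i) w) = 0"
        using pi[OF i] wi[OF i] is_componentD(1)[OF p] is_componentD(1)[OF comp_S[OF p]]
          is_componentD(1)[OF comp_S[OF w]]
        by (auto intro!: disjoint_sup)
      then have "inf (sup ((S ^^ i) p) ((S ^^ i) w)) (sup p w) = 0"
        using is_componentD(1)[OF p] is_componentD(1)[OF comp_S[OF p]]
        by (intro disjoint_sup) (auto simp: inf.commute intro: le_supI1)
      then show "inf (sup p w) ((S ^^ i) (sup p w)) = 0"
        by (simp add: unit_automorphismD(2)[OF S] inf.commute)
    qed
    then have "sup p w = p" by (intro max) auto
    then have "w \<le> v" using v(2) by (metis sup.cobounded2 order_trans)
    \<comment> \<open>\<open>w\<close> lies below both \<open>v\<close> and \<open>e - v\<close>, so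
      it is disjoint from itself.\<close>
    then have "inf w w = 0" using pw[OF w w _ wv] by blast
    then show False using nz by (simp add: w_def)
  qed
  then show ?thesis using that p pi by blast
qed

subsection \<open>Levels of the tower over a component\<close>

text \<open>The part of \<open>e\<close> whose last visit to \<open>p\<close> took place exactly \<open>k\<close> steps ago.\<close>

primrec level :: "('a::riesz_space \<Rightarrow> 'a) \<Rightarrow> 'a \<Rightarrow> 'a \<Rightarrow> nat \<Rightarrow> 'a" where
  "level S e p 0 = p"
| "level S e p (Suc k) = inf (S (level S e p k)) (e - p)"

context
  fixes S :: "'a::dedekind_complete_riesz_space \<Rightarrow> 'a" and e p :: 'a
  assumes aut: "unit_automorphism e S" and p: "is_component p e"
begin

private abbreviation A where "A \<equiv> level S e p"

private lemmas S = unit_automorphism_funpow[OF aut]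
  and U = unit_automorphism_funpow[OF unit_automorphism_inv[OF aut]]

lemma level_component: "is_component (A k) e"
  by (induction k)
    (auto simp: p aut is_component_inf is_component_compl unit_automorphism_component)

text \<open>Every level of positive index avoids \<open>p\<close>; for two positive indices, both
  levels lie below \<open>S\<close>-images of the preceding ones, which are disjoint by
  induction.\<close>

lemma level_disjoint:
  assumes "i < k"
  shows "inf (A i) (A k) = 0"
  using assms
proof (induction i arbitrary: k)
  case 0
  then obtain m where "k = Suc m" by (metis gr0_implies_Suc)
  then have "A k \<le> e - p" by simp
  then show ?case using disjoint_component_iff[OF level_component p] by (simp add: inf.commute)
next
  case (Suc i)
  then obtain m where m: "k = Suc m" "i < m" by (metis Suc_lessE)
  then have "inf (S (A i)) (S (A m)) = 0"
    using Suc.IH unit_automorphism_disjoint_iff[OF aut] by blast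
  then show ?case unfolding m(1)
    using level_component[of "Suc i"] level_component[of "Suc m"]
    by (elim disjoint_mono) (auto dest: is_componentD)
qed

text \<open>Going back one step in time undoes one step up the levels, since
  \<open>A (Suc k)\<close> lies below \<open>S (A k)\<close>.\<close>

lemma level_inv_le: "(inv S ^^ r) (A (k + r)) \<le> A k"
proof (induction r)
  case (Suc r)
  have "A (k + Suc r) \<le> (S ^^ 1) (A (k + r))" by simp
  then have "(inv S ^^ 1) (A (k + Suc r)) \<le> A (k + r)"
    by (metis unit_automorphism_funpow_inv[OF aut] unit_automorphism_le_iff[OF S])
  then have "(inv S ^^ r) ((inv S ^^ 1) (A (k + Suc r))) \<le> (inv S ^^ r) (A (k + r))"
    using unit_automorphism_le_iff[OF U] by blast
  then show ?case using Suc by (simp add: funpow_swap1)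
qed simp

text \<open>After one step a level either climbs, outside \<open>p\<close>, or falls into
  \<open>p\<close>. Formally, adding \<open>p\<close> distributes over the infimum that defines the
  next level.\<close>

lemma S_level_le: "S (A k) \<le> A (Suc k) + p"
proof -
  have "S (A k) \<le> inf (S (A k) + p) e"
    using is_componentD[OF p] is_componentD(2)[OF unit_automorphism_component[OF aut level_component]]
    by simp
  also have "\<dots> = A (Suc k) + p" by (simp add: add_inf_distrib_right)
  finally show ?thesis .
qed

lemma level_le_step: "A k \<le> inv S (A (Suc k)) + inv S p"
proof -
  have "(S ^^ 1) (A k) \<le> A (Suc k) + p" using S_level_le by simp
  then have "A k \<le> (inv S ^^ 1) (A (Suc k) + p)"
    using unit_automorphism_funpow_le_iff[OF aut] by blast
  then show ?thesis
    by (simp add: linear_add[OF unit_automorphismD(1)[OF unit_automorphism_inv[OF aut]]])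
qed

text \<open>Iterating \<open>level_le_step\<close>: the part of \<open>A k\<close> that does not
  climb for \<open>r\<close> steps meets \<open>p\<close> at one of the times \<open>1\<close> to
  \<open>r\<close>, and the sum pays for these meetings.\<close>

lemma level_le_inv: "A k \<le> (inv S ^^ r) (A (k + r)) + (\<Sum>i<r. (inv S ^^ Suc i) p)"
proof (induction r)
  case (Suc r)
  have "(inv S ^^ r) (A (k + r)) \<le> (inv S ^^ r) (inv S (A (Suc (k + r))) + inv S p)"
    using level_le_step unit_automorphism_le_iff[OF U] by blast
  also have "\<dots> = (inv S ^^ Suc r) (A (k + Suc r)) + (inv S ^^ Suc r) p"
    by (simp add: linear_add[OF unit_automorphismD(1)[OF U]] funpow_swap1)
  finally have "(inv S ^^ r) (A (k + r)) + (\<Sum>i<r. (inv S ^^ Suc i) p)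
      \<le> ((inv S ^^ Suc r) (A (k + Suc r)) + (inv S ^^ Suc r) p) + (\<Sum>i<r. (inv S ^^ Suc i) p)"
    by (rule add_right_mono)
  also have "\<dots> = (inv S ^^ Suc r) (A (k + Suc r)) + (\<Sum>i<Suc r. (inv S ^^ Suc i) p)"
    by (simp only: sum.lessThan_Suc ac_simps)
  finally show ?case using Suc.IH order_trans by blast
qed simp

text \<open>The supremum of the levels is a component above \<open>p\<close>, so by the assumption
  on invariant components only its invariance has to be shown.\<close>

lemma Sup_level_eq:
  assumes "linear T" "strictly_positive T" "\<And>f. T (S f) = T f"
    and inv: "\<And>v. is_component v e \<Longrightarrow> p \<le> v \<Longrightarrow> S v = v \<Longrightarrow> v = e"
  shows "Sup (range A) = e"
proof (rule inv)
  let ?v = "Sup (range A)"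
  have bdd: "bdd_above (range A)" by (rule bdd_above_components) (auto intro: level_component)
  have ub: "A k \<le> ?v" for k using bdd by (simp add: cSup_upper)
  show "is_component ?v e" by (rule is_component_Sup) (auto simp: level_component)
  show pv: "p \<le> ?v" using ub[of 0] by simp
  have "S (A k) \<le> ?v" for k
  proof -
    have "inf (A (Suc k)) p = 0" using level_disjoint[of 0 "Suc k"] by (simp add: inf.commute)
    then have "A (Suc k) + p = sup (A (Suc k)) p" by (rule disjoint_add_eq_sup)
    also have "\<dots> \<le> ?v" using ub[of "Suc k"] pv by (rule sup_least)
    finally show ?thesis using S_level_le order_trans by blast
  qed
  then have "?v \<le> (inv S ^^ 1) ?v"
    using unit_automorphism_funpow_le_iff[OF aut, of 1] by (intro cSup_least) auto
  then have le: "S ?v \<le> ?v" using unit_automorphism_funpow_le_iff[OF aut, of 1] by auto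
  \<comment> \<open>\<open>S\<close> can only shrink \<open>?v\<close>, and \<open>T\<close> does
    not see the difference; strict positivity then removes it.\<close>
  have "T (?v - S ?v) = 0" using assms(1,3) by (simp add: linear_diff)
  moreover have "0 \<le> ?v - S ?v" using le by simp
  ultimately have "?v - S ?v = 0" using assms(2) unfolding strictly_positive_def by blast
  then show "S ?v = ?v" by simp
qed

text \<open>\<open>S ^^ i\<close> moves the base into the levels whose index is \<open>i\<close>
  modulo \<open>n\<close>, so distinct floors are disjoint. A level fails to be covered only where
  it meets \<open>p\<close> before its index reaches the next multiple of \<open>n\<close>, or on
  reaching it.\<close>

lemma level_tower:
  assumes n: "1 \<le> n" and full: "Sup (range A) = e"
  obtains q where "is_component q e"
    and "\<And>i k. i < n \<Longrightarrow> k < n \<Longrightarrow> i \<noteq> k \<Longrightarrow> inf ((S ^^ i) q) ((S ^^ k) q) = 0"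
    and "e - (SUP i\<in>{..<n}. (S ^^ i) q) \<le> (\<Sum>i<n. (inv S ^^ Suc i) p)"
proof -
  \<comment> \<open>Each member is the part of \<open>A (m * n)\<close> that stays off
    \<open>p\<close> for the next \<open>n\<close> steps, written as the pullback of the level it
    reaches.\<close>
  define Q where "Q = range (\<lambda>m. (inv S ^^ n) (A (m * n + n)))"
  define q where "q = Sup Q"
  define B where "B i = (SUP m. A (m * n + i))" for i
  have Q: "is_component x e" if "x \<in> Q" for x
    using that unit_automorphism_component[OF U level_component] by (auto simp: Q_def)
  have q: "is_component q e"
    unfolding q_def by (rule is_component_Sup[OF Q]) (auto simp: Q_def)
  have Sq: "is_component ((S ^^ i) q) e" for i using unit_automorphism_component[OF S q] .
  have rangeA: "is_component x e" if "x \<in> range (\<lambda>m. A (f m))" for x and f :: "nat \<Rightarrow> nat"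
    using that level_component by auto
  have B: "is_component (B i) e" for i
    unfolding B_def by (rule is_component_Sup[OF rangeA]) auto
  have ubB: "A (m * n + i) \<le> B i" for m i
    unfolding B_def by (rule cSup_upper[OF _ bdd_above_components[OF rangeA]]) auto
  \<comment> \<open>Applying \<open>S ^^ i\<close> cancels \<open>i\<close> of the \<open>n\<close>
    backward steps, which leaves \<open>n - i\<close> steps down from \<open>A (m * n + n)\<close>
    to \<open>A (m * n + i)\<close>.\<close>
  have split: "(inv S ^^ n) x = (inv S ^^ i) ((inv S ^^ (n - i)) x)" if "i < n" for i x
    using that funpow_add[of i "n - i" "inv S"] by simp
  have SqB: "(S ^^ i) q \<le> B i" if i: "i < n" for i
  proof -
    have "(inv S ^^ n) (A (m * n + n)) \<le> (inv S ^^ i) (B i)" for m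
    proof -
      have "(inv S ^^ (n - i)) (A (m * n + n)) \<le> A (m * n + i)"
        using level_inv_le[of "n - i" "m * n + i"] i by simp
      also have "\<dots> \<le> B i" by (rule ubB)
      finally show ?thesis
        unfolding split[OF i] using unit_automorphism_le_iff[OF U] by blast
    qed
    then have "q \<le> (inv S ^^ i) (B i)" unfolding q_def Q_def by (intro cSup_least) auto
    then show ?thesis using unit_automorphism_funpow_le_iff[OF aut] by blast
  qed
  have nonneg: "0 \<le> A k" for k by (rule is_componentD(1)[OF level_component])
  have disjB: "inf (B i) (B k) = 0" if ik: "i < n" "k < n" "i \<noteq> k" for i k
  proof -
    have "inf (A (l * n + k)) (A (m * n + i)) = 0" for m l
    proof -
      have "(m * n + i) mod n \<noteq> (l * n + k) mod n" using ik by simp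
      then have "m * n + i \<noteq> l * n + k" by metis
      then show ?thesis by (metis level_disjoint nat_neq_iff inf.commute)
    qed
    \<comment> \<open>The two suprema are taken one at a time: first over the levels in
      \<open>B k\<close>, then over those in \<open>B i\<close>.\<close>
    then have "inf (B k) (A (m * n + i)) = 0" for m
      by (subst B_def, intro disjoint_Sup bdd_above_components[OF rangeA])
        (auto intro: nonneg)
    then have "inf (A (m * n + i)) (B k) = 0" for m by (simp only: inf.commute)
    then show ?thesis
      by (subst B_def, intro disjoint_Sup bdd_above_components[OF rangeA])
        (auto intro: nonneg is_componentD(1)[OF B])
  qed
  let ?R = "SUP i\<in>{..<n}. (S ^^ i) q" and ?P = "\<Sum>i<n. (inv S ^^ Suc i) p"
  have "A k \<le> ?R + ?P" for k
  proof -
    define i where "i = k mod n"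
    define m where "m = k div n"
    have i: "i < n" and k: "k = m * n + i" using n by (simp_all add: i_def m_def)
    \<comment> \<open>\<open>n - i\<close> steps bring level \<open>k\<close> up to the next
      multiple of \<open>n\<close>, where \<open>q\<close> was cut off; this takes at most
      \<open>n\<close> terms of \<open>?P\<close>.\<close>
    have kr: "k + (n - i) = m * n + n" using i k by simp
    have "(inv S ^^ n) (A (m * n + n)) \<le> q"
      unfolding q_def by (rule cSup_upper[OF _ bdd_above_components[OF Q]]) (auto simp: Q_def)
    then have "(S ^^ i) ((inv S ^^ n) (A (m * n + n))) \<le> (S ^^ i) q"
      using unit_automorphism_le_iff[OF S] by blast
    then have "(inv S ^^ (n - i)) (A (m * n + n)) \<le> (S ^^ i) q"
      by (simp add: split[OF i] unit_automorphism_funpow_inv[OF aut])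
    also have "\<dots> \<le> ?R" using i by (intro cSup_upper) (auto intro: bdd_above_finite)
    finally have "(inv S ^^ (n - i)) (A (k + (n - i))) \<le> ?R" by (simp only: kr)
    moreover have "(\<Sum>i<n - i. (inv S ^^ Suc i) p) \<le> ?P"
      using is_componentD(1)[OF unit_automorphism_component[OF U p]]
      by (intro sum_mono2) (auto simp del: funpow.simps)
    ultimately show ?thesis using level_le_inv[of k "n - i"] by (meson add_mono order_trans)
  qed
  then have "Sup (range A) \<le> ?R + ?P" by (intro cSup_least) auto
  then have "e \<le> ?R + ?P" using full by simp
  then have cover: "e - ?R \<le> ?P" by (metis diff_le_eq add.commute)
  have "inf ((S ^^ i) q) ((S ^^ k) q) = 0" if "i < n" "k < n" "i \<noteq> k" for i k
    using disjoint_mono[OF disjB[OF that] SqB SqB] that is_componentD(1)[OF Sq] by blast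
  then show ?thesis using that q cover by blast
qed

end

section \<open>Choice of the number \<open>N\<close> of disjoint translates and the estimate under
  \<open>T\<close>\<close>

theorem theorem4p5:
  fixes T S :: "'a::dedekind_complete_riesz_space \<Rightarrow> 'a"
    and e :: 'a
    and j :: "'a \<Rightarrow> 'b::dedekind_complete_riesz_space"
    and n :: nat
    and \<epsilon> :: real
  assumes "CEPS T S e"
    and "conditionally_ergodic T S"
    and "strictly_positive T"
    and "universal_completion j"
    and "T_universally_complete j T"
    and "surj S"
    and "aperiodic S e e"
    and "1 \<le> n"
    and "0 < \<epsilon>"
  shows "\<exists>q. is_component q e \<and>
    (\<forall>i<n. \<forall>k<n. i \<noteq> k \<longrightarrow> inf ((S ^^ i) q) ((S ^^ k) q) = 0) \<and>
    T (e - (SUP i\<in>{..<n}. (S ^^ i) q)) \<le> \<epsilon> *\<^sub>R e"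
proof -
  have T: "linear T" "\<And>f. 0 \<le> f \<Longrightarrow> 0 \<le> T f" "T e = e" "\<And>f. T (S f) = T f"
    and hom: "riesz_hom S" and Se: "S e = e" and e0: "0 \<le> e"
    using assms(1)
    by (auto simp: CEPS_def conditional_expectation_def positive_operator_def weak_order_unit_def)
  have T_mono: "T f \<le> T g" if "f \<le> g" for f g
    using T(2)[of "g - f"] that by (simp add: linear_diff[OF T(1)])
  have linS: "linear S" and sup: "S (sup f g) = sup (S f) (S g)" for f g
    using hom by (auto simp: riesz_hom_def)
  have "inj S"
    unfolding linear_injective_0[OF linS]
  proof (intro allI impI)
    fix f assume f: "S f = 0"
    \<comment> \<open>\<open>S\<close> commutes with the modulus, so \<open>T\<close> of the modulus
      of \<open>f\<close> vanishes and strict positivity yields injectivity.\<close>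
    then have "S \<bar>f\<bar> = 0" by (simp add: abs_lattice sup linear_neg[OF linS])
    then have "T \<bar>f\<bar> = 0" using T(4)[of "\<bar>f\<bar>"] by (simp add: linear_0[OF T(1)])
    then have "\<bar>f\<bar> = 0" using assms(3) abs_ge_zero unfolding strictly_positive_def by blast
    then show "f = 0" by simp
  qed
  then have aut: "unit_automorphism e S"
    using assms(6) hom Se by (simp add: unit_automorphism_def bij_def)
  \<comment> \<open>Large enough for \<open>n / N\<close> to be at most \<open>\<epsilon>\<close>;
    the added 1 keeps \<open>N\<close> positive.\<close>
  define N where "N = nat \<lceil>real n / \<epsilon>\<rceil> + 1"
  have N: "1 \<le> N" "real n / real N \<le> \<epsilon>"
  proof -
    have "real n / \<epsilon> \<le> real N" unfolding N_def by linarith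
    then have "real n \<le> \<epsilon> * real N" using assms(9) by (simp add: field_simps)
    moreover have "0 < real N" by (simp add: N_def)
    ultimately show "real n / real N \<le> \<epsilon>" by (simp add: field_simps)
  qed (simp add: N_def)
  obtain p where p: "is_component p e" and pi: "\<And>i. 0 < i \<Longrightarrow> i < N \<Longrightarrow> inf p ((S ^^ i) p) = 0"
    and max: "\<And>v. is_component v e \<Longrightarrow> p \<le> v \<Longrightarrow> S v = v \<Longrightarrow> v = e"
    using maximal_wandering_component[OF aut assms(7) N(1)] by blast
  have "Sup (range (level S e p)) = e"
    by (rule Sup_level_eq[OF aut p T(1) assms(3)]) (auto intro: T(4) max)
  then obtain q where q: "is_component q e"
      "\<And>i k. i < n \<Longrightarrow> k < n \<Longrightarrow> i \<noteq> k \<Longrightarrow> inf ((S ^^ i) q) ((S ^^ k) q) = 0"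
    and cover: "e - (SUP i\<in>{..<n}. (S ^^ i) q) \<le> (\<Sum>i<n. (inv S ^^ Suc i) p)"
    using level_tower[OF aut p assms(8)] by blast
  have TS: "T ((S ^^ i) f) = T f" for i f by (induction i) (simp_all add: T(4))
  have TU: "T ((inv S ^^ i) f) = T f" for i f
    using TS[of i "(inv S ^^ i) f"] by (simp add: unit_automorphism_funpow_inv[OF aut])
  \<comment> \<open>\<open>N\<close> disjoint translates fit below \<open>e\<close> and all have the
    same image under \<open>T\<close>, which bounds \<open>N\<close> times \<open>T p\<close> by
    \<open>e\<close>.\<close>
  have "(\<Sum>i<N. (S ^^ i) p) \<le> e"
  proof (rule sum_disjoint_components_le[OF e0])
    fix i k assume "i < k" "k < N"
    then have "inf p ((S ^^ (k - i)) p) = 0" by (intro pi) auto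
    then have "inf ((S ^^ i) p) ((S ^^ i) ((S ^^ (k - i)) p)) = 0"
      using unit_automorphism_disjoint_iff[OF unit_automorphism_funpow[OF aut]] by blast
    then show "inf ((S ^^ i) p) ((S ^^ k) p) = 0"
      using \<open>i < k\<close> funpow_add[of i "k - i" S] by simp
  qed (rule unit_automorphism_component[OF unit_automorphism_funpow[OF aut] p])
  then have "T (\<Sum>i<N. (S ^^ i) p) \<le> T e" by (rule T_mono)
  then have TN: "real N *\<^sub>R T p \<le> e"
    by (simp add: linear_sum[OF T(1)] TS T(3) sum_constant_scaleR)
  have "T (e - (SUP i\<in>{..<n}. (S ^^ i) q)) \<le> T (\<Sum>i<n. (inv S ^^ Suc i) p)"
    using cover by (rule T_mono)
  also have "\<dots> = real n *\<^sub>R T p"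
    by (simp del: funpow.simps add: linear_sum[OF T(1)] TU sum_constant_scaleR)
  \<comment> \<open>Regrouping exposes \<open>N\<close> times \<open>T p\<close>, the quantity
    already bounded by \<open>e\<close>.\<close>
  also have "\<dots> = (real n / real N) *\<^sub>R (real N *\<^sub>R T p)" using N(1) by simp
  also have "\<dots> \<le> (real n / real N) *\<^sub>R e" using TN by (rule scaleR_left_mono) simp
  also have "\<dots> \<le> \<epsilon> *\<^sub>R e" using N(2) e0 by (rule scaleR_right_mono)
  finally show ?thesis using q by blast
qed

end
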